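(* Let $\mathcal L$ be a finite set of positive integers, and write $$\mathcal L_{\mathrm{even}}=\mathcal L\cap 2\mathbb N,\qquad \mathcal L_{\mathrm{odd}}=\mathcal L\setminus\mathcal L_{\mathrm{even}},\qquad e=|\mathcal L_{\mathrm{even}}|,\qquad \mathcal L_{\mathrm{odd}}+1=\{\ell+1:\ell\in\mathcal L_{\mathrm{odd}}\}.$$ There is a threshold $n_0=n_0(\mathcal L)$ such that for all $n\ge n_0$, any family $\mathcal F\subseteq 2^{[n]}$ with $|A\triangle B|\in\mathcal L$ for all distinct $A,B\in\mathcal F$ satisfies $$|\mathcal F|\le\begin{cases}\displaystyle\sum_{i=0}^{e}\binom{n-1}{i}, & \text{if }\mathcal L\subseteq 2\mathbb N,\\[10pt] \displaystyle 2\sum_{i=0}^{e}\binom{n-1}{i}, & \text{if }\mathcal L\not\subseteq 2\mathbb N.\end{cases}$$ Moreover, if $\mathcal L\not\subseteq 2\mathbb N$ and $\mathcal L_{\mathrm{odd}}+1\subseteq\mathcal L_{\mathrm{even}}$, then (for all $n\ge n_0$) every such family satisfies the tighter bound $$|\mathcal F|\le\sum_{i=0}^{e}\binom{n}{i}.$$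
   Context: Here $[n]=\{1,\dots,n\}$, $2^{[n]}$ is the family of all subsets of $[n]$, $\triangle$ denotes symmetric difference of sets, and $2\mathbb N$ is the set of even integers among the positive integers. *)

theory Defs
  imports Complex_Main
begin

definition distance_family :: "nat set \<Rightarrow> nat \<Rightarrow> nat set set \<Rightarrow> bool" where
  "distance_family L n F \<longleftrightarrow>
     F \<subseteq> Pow {1..n} \<and> (\<forall>A\<in>F. \<forall>B\<in>F. A \<noteq> B \<longrightarrow> card (sym_diff A B) \<in> L)"

definition even_part :: "nat set \<Rightarrow> nat set" where
  "even_part L = {l \<in> L. even l}"

definition odd_part :: "nat set \<Rightarrow> nat set" where
  "odd_part L = L - even_part L"

end

theory Submission
  imports Defs
begin

text \<open>
  The proof is an inertia (Cvetkovic) argument on the cube. For a code with distances in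
  a set \<open>L\<close> of size \<open>e\<close>, consider the kernel
  \<open>M(A, B) = (\<Prod>l\<in>L. 2 l - 2 |A \<triangle> B|)\<close>. It is a positive multiple of the
  identity on the code. On the whole cube it is diagonalised by the characters
  \<open>A \<mapsto> (- 1) ^ |S \<inter> A|\<close>; as soon as \<open>n \<ge> 2 l\<close> for all \<open>l \<in> L\<close>, the
  eigenvalue of \<open>S\<close> vanishes for \<open>|S| > e\<close> and otherwise has sign
  \<open>(- 1) ^ (e + |S|)\<close> or is zero. Hence the code has at most as many elements as there are
  sets \<open>S\<close> with \<open>|S| \<le> e\<close> and \<open>|S| \<equiv> e\<close> modulo 2, which is
  \<open>\<Sum>i\<le>e. (n - 1) choose i\<close>. Applied to the distances in the even part of \<open>L\<close>, this bounds the
  subfamilies of even sets and of odd sets. If \<open>l + 1\<close> lies in \<open>L\<close> for every odd \<open>l \<in> L\<close>, adding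
  a parity bit turns the whole family into a code with even distances in dimension \<open>n + 1\<close>.
\<close>

section \<open>Characters of the cube and toggling one coordinate\<close>

definition chi :: "'a set \<Rightarrow> 'a set \<Rightarrow> real" where
  "chi S A = (\<Prod>i\<in>S. if i \<in> A then - 1 else 1)"

lemma chi_sym_diff: "chi S (sym_diff A B) = chi S A * chi S B"
  unfolding chi_def prod.distrib[symmetric] by (rule prod.cong) auto

text \<open>Multiplying by the character of \<open>{i}\<close> moves the index by one toggle; this
  is how a linear factor of the kernel acts on an expansion in characters.\<close>

lemma chi_toggle:
  assumes "finite S"
  shows "chi (sym_diff S {i}) A = chi S A * (if i \<in> A then - 1 else 1)"
proof (cases "i \<in> S")
  case True
  then have "sym_diff S {i} = S - {i}" by auto
  then show ?thesis
    using prod.remove[OF assms True, of "\<lambda>i. if i \<in> A then - 1 else (1::real)"]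
    by (simp add: chi_def)
next
  case False
  then have "sym_diff S {i} = insert i S" by auto
  then show ?thesis using False assms by (simp add: chi_def)
qed

lemma card_toggle:
  assumes "finite S"
  shows "card (sym_diff S {i}) = (if i \<in> S then card S - 1 else Suc (card S))"
proof (cases "i \<in> S")
  case True
  then have "sym_diff S {i} = S - {i}" by auto
  then show ?thesis using True assms by simp
next
  case False
  then have "sym_diff S {i} = insert i S" by auto
  then show ?thesis using False assms by simp
qed

lemma minus_one_power_card_toggle:
  assumes "finite S"
  shows "(- 1 :: real) ^ card (sym_diff S {i}) = - ((- 1) ^ card S)"
proof (cases "i \<in> S")
  case True
  then have "card S = Suc (card S - 1)"
    using assms by (metis card_gt_0_iff Suc_pred' empty_iff)
  then show ?thesis
    using True card_toggle[OF assms, of i] by (metis minus_minus mult_minus1 power_Suc)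
next
  case False
  then show ?thesis unfolding card_toggle[OF assms] by simp
qed

section \<open>Sign pattern of the kernel in the basis of characters\<close>

lemma sum_signs:
  assumes "finite X" "D \<subseteq> X"
  shows "(\<Sum>i\<in>X. if i \<in> D then - 1 else (1::real)) = real (card X) - 2 * real (card D)"
proof -
  have "(\<Sum>i\<in>X. if i \<in> D then - 1 else (1::real)) = (\<Sum>i\<in>X. 1 - 2 * of_bool (i \<in> D))"
    by (rule sum.cong) auto
  also have "\<dots> = real (card X) - 2 * (\<Sum>i\<in>X. of_bool (i \<in> D))"
    by (simp add: sum_subtractf sum_distrib_left)
  also have "(\<Sum>i\<in>X. of_bool (i \<in> D)) = real (card D)"
    using assms by (simp add: Int_absorb1 flip: Int_def)
  finally show ?thesis .
qed

text \<open>
  Multiplication by \<open>2 l - 2 |D| = (2 l - |X|) + (\<Sum>i\<in>X. chi {i} D)\<close> either keeps the index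
  \<open>S\<close> and contributes a nonpositive factor, or changes \<open>|S|\<close> by one. In both cases the
  sign pattern is preserved.
\<close>

lemma character_expansion:
  fixes X :: "'a set"
  assumes "finite X" "finite L" "\<forall>l\<in>L. 2 * l \<le> card X"
  shows "\<exists>c. (\<forall>S\<subseteq>X. 0 \<le> c S) \<and> (\<forall>S\<subseteq>X. card L < card S \<longrightarrow> c S = 0) \<and>
    (\<forall>D\<subseteq>X. (\<Prod>l\<in>L. 2 * real l - 2 * real (card D)) =
      (\<Sum>S\<in>Pow X. (- 1) ^ (card L + card S) * c S * chi S D))"
  using assms(2,3)
proof (induction L rule: finite_induct)
  case empty
  have "(\<Sum>S\<in>Pow X. (- 1) ^ card S * of_bool (S = {}) * chi S D) = 1" for D
  proof -
    have "(\<Sum>S\<in>Pow X. (- 1) ^ card S * of_bool (S = {}) * chi S D)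
      = (\<Sum>S\<in>Pow X. if S = {} then 1 else 0)"
      by (rule sum.cong) (auto simp: chi_def)
    also have "\<dots> = 1" using assms(1) by simp
    finally show ?thesis .
  qed
  then show ?case
    by (intro exI[of _ "\<lambda>S. of_bool (S = {})"]) auto
next
  case (insert l L)
  from insert.IH insert.prems obtain c
    where c0: "\<And>S. S \<subseteq> X \<Longrightarrow> 0 \<le> c S"
      and cz: "\<And>S. S \<subseteq> X \<Longrightarrow> card L < card S \<Longrightarrow> c S = 0"
      and ce: "\<And>D. D \<subseteq> X \<Longrightarrow> (\<Prod>l\<in>L. 2 * real l - 2 * real (card D)) =
      (\<Sum>S\<in>Pow X. (- 1) ^ (card L + card S) * c S * chi S D)"
    by auto
  \<comment> \<open>Coefficients after multiplication by \<open>2 l - 2 |D|\<close>: every toggle of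
    \<open>S\<close> contributes through some \<open>chi {i}\<close>, and the constant term enters
    as \<open>card X - 2 l\<close>, which is nonnegative; its minus sign is absorbed by
    \<open>card L\<close> growing by one.\<close>
  define c' where "c' S = (\<Sum>i\<in>X. c (sym_diff S {i})) + (real (card X) - 2 * real l) * c S" for S
  have l: "2 * real l \<le> real (card X)" using insert.prems by simp
  have fin: "finite S" if "S \<subseteq> X" for S using that assms(1) by (rule finite_subset)
  have tog: "sym_diff S {i} \<subseteq> X" if "S \<subseteq> X" "i \<in> X" for S i using that by auto
  have "0 \<le> c' S" if "S \<subseteq> X" for S
    unfolding c'_def using l that by (intro add_nonneg_nonneg sum_nonneg mult_nonneg_nonneg c0) auto
  moreover have "c' S = 0" if S: "S \<subseteq> X" and "card (insert l L) < card S" for S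
  proof -
    \<comment> \<open>\<open>card S\<close> exceeds \<open>card L\<close> by at least two, so a set
      with one element removed from \<open>S\<close> is still large enough for \<open>c\<close> to
      vanish on it.\<close>
    have big: "Suc (card L) < card S" using that insert.hyps by simp
    have "c (sym_diff S {i}) = 0" if "i \<in> X" for i
      using big card_toggle[OF fin[OF S], of i] S that by (intro cz tog) (auto split: if_splits)
    then show ?thesis using big S by (simp add: c'_def cz)
  qed
  moreover have "(\<Prod>l\<in>insert l L. 2 * real l - 2 * real (card D)) =
      (\<Sum>S\<in>Pow X. (- 1) ^ (card (insert l L) + card S) * c' S * chi S D)" if D: "D \<subseteq> X" for D
  proof -
    define s where "s i = (if i \<in> D then - 1 else (1::real))" for i
    \<comment> \<open>Reindexing by the involution \<open>S \<mapsto> sym_diff S {i}\<close> absorbs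
      \<open>s i\<close> into the character; the toggle changes the parity of \<open>card S\<close>,
      whence the minus sign.\<close>
    have shift: "(\<Sum>S\<in>Pow X. (- 1) ^ (card L + card S) * c S * chi S D * s i) =
      (\<Sum>S\<in>Pow X. - ((- 1) ^ (card L + card S) * c (sym_diff S {i}) * chi S D))"
      if i: "i \<in> X" for i
    proof (rule sum.reindex_bij_witness[of _ "\<lambda>S. sym_diff S {i}" "\<lambda>S. sym_diff S {i}"])
      fix S assume "S \<in> Pow X"
      then have S: "S \<subseteq> X" by simp
      show inv: "sym_diff (sym_diff S {i}) {i} = S" by auto
      show "sym_diff S {i} \<in> Pow X" using tog[OF S i] by simp
      show "- ((- 1) ^ (card L + card (sym_diff S {i})) * c (sym_diff (sym_diff S {i}) {i})
          * chi (sym_diff S {i}) D) = (- 1) ^ (card L + card S) * c S * chi S D * s i"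
        unfolding inv power_add minus_one_power_card_toggle[OF fin[OF S]] chi_toggle[OF fin[OF S]]
        by (simp add: s_def)
    qed (use i in auto)
    have "(\<Prod>l\<in>insert l L. 2 * real l - 2 * real (card D)) =
      ((\<Sum>i\<in>X. s i) - (real (card X) - 2 * real l)) *
        (\<Sum>S\<in>Pow X. (- 1) ^ (card L + card S) * c S * chi S D)"
      unfolding s_def sum_signs[OF assms(1) D] using insert.hyps ce[OF D] by simp
    also have "\<dots> = (\<Sum>i\<in>X. \<Sum>S\<in>Pow X. (- 1) ^ (card L + card S) * c S * chi S D * s i)
      - (\<Sum>S\<in>Pow X. (- 1) ^ (card L + card S) * c S * chi S D * (real (card X) - 2 * real l))"
      by (subst left_diff_distrib, subst sum_product, subst sum_distrib_left) (simp only: mult_ac)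
    also have "(\<Sum>i\<in>X. \<Sum>S\<in>Pow X. (- 1) ^ (card L + card S) * c S * chi S D * s i) =
      (\<Sum>i\<in>X. \<Sum>S\<in>Pow X. - ((- 1) ^ (card L + card S) * c (sym_diff S {i}) * chi S D))"
      by (intro sum.cong refl shift)
    also have "\<dots> =
      (\<Sum>S\<in>Pow X. \<Sum>i\<in>X. - ((- 1) ^ (card L + card S) * c (sym_diff S {i}) * chi S D))"
      by (rule sum.swap)
    also have "\<dots> - (\<Sum>S\<in>Pow X. (- 1) ^ (card L + card S) * c S * chi S D
        * (real (card X) - 2 * real l)) =
      (\<Sum>S\<in>Pow X. (- 1) ^ (card (insert l L) + card S) * c' S * chi S D)"
      unfolding sum_subtractf[symmetric] using insert.hyps
      by (intro sum.cong refl)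
        (simp add: c'_def sum_negf sum_distrib_left sum_distrib_right algebra_simps)
    finally show ?thesis .
  qed
  ultimately show ?case by blast
qed

section \<open>Underdetermined linear systems and the inertia bound\<close>

lemma homogeneous_system_nontrivial_solution:
  fixes a :: "'i \<Rightarrow> 'x \<Rightarrow> 'k::field"
  assumes "finite I" "finite X" "card I < card X"
  shows "\<exists>v. (\<exists>x\<in>X. v x \<noteq> 0) \<and> (\<forall>i\<in>I. (\<Sum>x\<in>X. a i x * v x) = 0)"
  using assms
proof (induction I arbitrary: X a rule: finite_induct)
  case empty
  then have "X \<noteq> {}" by auto
  then show ?case by (intro exI[of _ "\<lambda>_. 1"]) auto
next
  case (insert i I)
  show ?case
  proof (cases "\<forall>x\<in>X. a i x = 0")
    case True
    moreover obtain v where "\<exists>x\<in>X. v x \<noteq> 0" "\<forall>i\<in>I. (\<Sum>x\<in>X. a i x * v x) = 0"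
      using insert.IH[of X a] insert.prems insert.hyps by auto
    ultimately show ?thesis by (intro exI[of _ v]) auto
  next
    case False
    then obtain z where z: "z \<in> X" "a i z \<noteq> 0" by auto
    define Y where "Y = X - {z}"
    have Y: "finite Y" "z \<notin> Y" "X = insert z Y" using insert.prems z by (auto simp: Y_def)
    have "card I < card Y" using insert.prems insert.hyps Y by simp
    \<comment> \<open>Eliminate the unknown at \<open>z\<close>: these are the remaining equations
      once equation \<open>i\<close> is solved for it, and \<open>t\<close> below is the solved
      value.\<close>
    from insert.IH[OF Y(1) this, of "\<lambda>j x. a j x - a j z * a i x / a i z"]
    obtain v where v: "\<exists>x\<in>Y. v x \<noteq> 0"
      "\<And>j. j \<in> I \<Longrightarrow> (\<Sum>x\<in>Y. (a j x - a j z * a i x / a i z) * v x) = 0"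
      by blast
    define t where "t = - (\<Sum>x\<in>Y. a i x * v x) / a i z"
    have split: "(\<Sum>x\<in>X. a j x * (v(z := t)) x) = a j z * t + (\<Sum>x\<in>Y. a j x * v x)" for j
    proof -
      have "(\<Sum>x\<in>Y. a j x * (v(z := t)) x) = (\<Sum>x\<in>Y. a j x * v x)"
        using Y by (intro sum.cong) auto
      then show ?thesis using Y by simp
    qed
    have "(\<Sum>x\<in>X. a j x * (v(z := t)) x) = 0" if "j \<in> I" for j
    proof -
      have "a j z * t + (\<Sum>x\<in>Y. a j x * v x) =
          (\<Sum>x\<in>Y. (a j x - a j z * a i x / a i z) * v x)"
        by (simp add: t_def left_diff_distrib sum_subtractf sum_distrib_left sum_divide_distrib
            mult.assoc)
      then show ?thesis using split[of j] v(2)[OF that] by simp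
    qed
    moreover have "(\<Sum>x\<in>X. a i x * (v(z := t)) x) = 0"
      unfolding split using z by (simp add: t_def)
    moreover have "\<exists>x\<in>X. (v(z := t)) x \<noteq> 0" using v(1) Y by auto
    ultimately show ?thesis by blast
  qed
qed

text \<open>If \<open>F\<close> were larger, some nonzero vector \<open>v\<close> on
  \<open>F\<close> would be orthogonal to every character with index in \<open>?E\<close>. The
  quadratic form of the kernel at \<open>v\<close> would then be positive, as the kernel is a
  positive multiple of the identity on \<open>F\<close>, and also nonpositive, as only indices in
  \<open>?E\<close> can carry positive eigenvalues.\<close>

lemma distance_code_inertia_bound:
  fixes X :: "'a set"
  assumes X: "finite X" and L: "finite L" "\<And>l. l \<in> L \<Longrightarrow> 0 < l" "\<And>l. l \<in> L \<Longrightarrow> 2 * l \<le> card X"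
    and F: "F \<subseteq> Pow X" "\<And>A B. A \<in> F \<Longrightarrow> B \<in> F \<Longrightarrow> A \<noteq> B \<Longrightarrow> card (sym_diff A B) \<in> L"
  shows "card F \<le> card {S. S \<subseteq> X \<and> card S \<le> card L \<and> even (card L + card S)}"
    (is "_ \<le> card ?E")
proof (rule ccontr)
  assume "\<not> card F \<le> card ?E"
  moreover have finF: "finite F" using F(1) X by (meson finite_Pow_iff finite_subset)
  moreover have "finite ?E" using X by simp
  ultimately have "\<exists>v. (\<exists>A\<in>F. v A \<noteq> 0) \<and> (\<forall>S\<in>?E. (\<Sum>A\<in>F. chi S A * v A) = 0)"
    by (intro homogeneous_system_nontrivial_solution) simp_all
  then obtain v where v: "\<exists>A\<in>F. v A \<noteq> 0" "\<And>S. S \<in> ?E \<Longrightarrow> (\<Sum>A\<in>F. chi S A * v A) = 0"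
    by blast
  obtain c where c: "\<And>S. S \<subseteq> X \<Longrightarrow> 0 \<le> c S"
      "\<And>S. S \<subseteq> X \<Longrightarrow> card L < card S \<Longrightarrow> c S = 0"
      "\<And>D. D \<subseteq> X \<Longrightarrow> (\<Prod>l\<in>L. 2 * real l - 2 * real (card D)) =
      (\<Sum>S\<in>Pow X. (- 1) ^ (card L + card S) * c S * chi S D)"
    using character_expansion[OF X L(1)] L(3) by blast
  define p where "p A B = (\<Prod>l\<in>L. 2 * real l - 2 * real (card (sym_diff A B)))" for A B :: "'a set"
  define q where "q = (\<Prod>l\<in>L. 2 * real l)"
  have "q > 0" unfolding q_def using L(2) by (intro prod_pos) auto
  \<comment> \<open>For \<open>A \<noteq> B\<close> the factor with
    \<open>l = card (sym_diff A B)\<close> vanishes.\<close>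
  have diag: "p A B = (if A = B then q else 0)" if "A \<in> F" "B \<in> F" for A B
    using F(2)[OF that] L(1) by (auto simp: p_def q_def)
  have "(\<Sum>A\<in>F. \<Sum>B\<in>F. v A * v B * p A B) = (\<Sum>A\<in>F. q * (v A)\<^sup>2)"
  proof (rule sum.cong[OF refl])
    fix A assume A: "A \<in> F"
    have "(\<Sum>B\<in>F. v A * v B * p A B) = (\<Sum>B\<in>F. if A = B then q * (v A)\<^sup>2 else 0)"
      by (rule sum.cong) (auto simp: diag A power2_eq_square)
    then show "(\<Sum>B\<in>F. v A * v B * p A B) = q * (v A)\<^sup>2" using A finF by simp
  qed
  also have "\<dots> > 0"
  proof -
    obtain A where "A \<in> F" "v A \<noteq> 0" using v(1) by blast
    then show ?thesis using finF \<open>q > 0\<close> by (intro sum_pos2[of _ A]) auto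
  qed
  finally have pos: "(\<Sum>A\<in>F. \<Sum>B\<in>F. v A * v B * p A B) > 0" .
  have "(\<Sum>A\<in>F. \<Sum>B\<in>F. v A * v B * p A B) = (\<Sum>A\<in>F. \<Sum>B\<in>F. \<Sum>S\<in>Pow X.
      (- 1) ^ (card L + card S) * c S * ((chi S A * v A) * (chi S B * v B)))"
  proof (intro sum.cong refl)
    fix A B assume "A \<in> F" "B \<in> F"
    then have "sym_diff A B \<subseteq> X" using F(1) by auto
    from c(3)[OF this] show "v A * v B * p A B = (\<Sum>S\<in>Pow X.
      (- 1) ^ (card L + card S) * c S * ((chi S A * v A) * (chi S B * v B)))"
      unfolding p_def chi_sym_diff by (simp add: sum_distrib_left mult_ac)
  qed
  also have "\<dots> = (\<Sum>A\<in>F. \<Sum>S\<in>Pow X. \<Sum>B\<in>F.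
      (- 1) ^ (card L + card S) * c S * ((chi S A * v A) * (chi S B * v B)))"
    by (intro sum.cong refl sum.swap)
  also have "\<dots> = (\<Sum>S\<in>Pow X. \<Sum>A\<in>F. \<Sum>B\<in>F.
      (- 1) ^ (card L + card S) * c S * ((chi S A * v A) * (chi S B * v B)))"
    by (rule sum.swap)
  \<comment> \<open>Each character contributes a rank-one kernel, so its double sum over
    \<open>F\<close> is a square.\<close>
  also have "\<dots> = (\<Sum>S\<in>Pow X. (- 1) ^ (card L + card S) * c S * (\<Sum>A\<in>F. chi S A * v A)\<^sup>2)"
    unfolding power2_eq_square sum_product by (simp add: sum_distrib_left)
  also have "\<dots> \<le> 0"
  proof (rule sum_nonpos)
    fix S assume "S \<in> Pow X"
    then have S: "S \<subseteq> X" by simp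
    show "(- 1) ^ (card L + card S) * c S * (\<Sum>A\<in>F. chi S A * v A)\<^sup>2 \<le> 0"
    \<comment> \<open>Indices in \<open>?E\<close> contribute zero by the choice of
      \<open>v\<close>, large ones because \<open>c S = 0\<close>, and those of the other parity
      carry a minus sign.\<close>
    proof (cases "card S \<le> card L \<and> even (card L + card S)")
      case True
      then show ?thesis using v(2)[of S] S by simp
    next
      case False
      then consider "card L < card S" | "odd (card L + card S)" by linarith
      then show ?thesis
      proof cases
        case 1
        then show ?thesis using c(2) S by simp
      next
        case 2
        then show ?thesis using c(1)[OF S] by simp
      qed
    qed
  qed
  finally show False using pos by simp
qed

section \<open>Counting the index sets\<close>

lemma card_subsets_card_le:
  assumes "finite X"
  shows "card {S. S \<subseteq> X \<and> card S \<le> e} = (\<Sum>i=0..e. card X choose i)"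
proof -
  have "{S. S \<subseteq> X \<and> card S \<le> e} = (\<Union>i\<in>{0..e}. {S. S \<subseteq> X \<and> card S = i})" by auto
  also have "card \<dots> = (\<Sum>i\<in>{0..e}. card {S. S \<subseteq> X \<and> card S = i})"
    using assms by (intro card_UN_disjoint) auto
  also have "\<dots> = (\<Sum>i=0..e. card X choose i)" by (simp add: n_subsets assms)
  finally show ?thesis .
qed

text \<open>Once the parity of \<open>card S\<close> is fixed, \<open>S - {z}\<close> determines
  \<open>S\<close>, since its parity tells whether \<open>z\<close> was removed. Deleting
  \<open>z\<close> therefore injects these sets into the small subsets of
  \<open>X - {z}\<close>.\<close>

lemma card_subsets_card_le_parity:
  assumes "finite X" "z \<in> X"
  shows "card {S. S \<subseteq> X \<and> card S \<le> e \<and> even (e + card S)} \<le> (\<Sum>i=0..e. (card X - 1) choose i)"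
    (is "card ?E \<le> _")
proof -
  have "inj_on (\<lambda>S. S - {z}) ?E"
  proof (rule inj_onI)
    fix S T assume S: "S \<in> ?E" and T: "T \<in> ?E" and eq: "S - {z} = T - {z}"
    have fin: "finite S" "finite T" using S T assms(1) by (auto intro: finite_subset)
    have "z \<in> S \<longleftrightarrow> z \<in> T"
    proof (rule ccontr)
      assume "(z \<in> S) \<noteq> (z \<in> T)"
      then have "S = insert z T \<and> z \<notin> T \<or> T = insert z S \<and> z \<notin> S" using eq by auto
      then have "card S = Suc (card T) \<or> card T = Suc (card S)" using fin by auto
      then show False using S T by auto
    qed
    then show "S = T" using eq by auto
  qed
  moreover have "(\<lambda>S. S - {z}) ` ?E \<subseteq> {S. S \<subseteq> X - {z} \<and> card S \<le> e}"
  proof (rule image_subsetI)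
    fix S assume "S \<in> ?E"
    moreover from this have "card (S - {z}) \<le> card S"
      using assms(1) by (intro card_mono) (auto intro: finite_subset)
    ultimately show "S - {z} \<in> {S. S \<subseteq> X - {z} \<and> card S \<le> e}" by auto
  qed
  ultimately have "card ?E \<le> card {S. S \<subseteq> X - {z} \<and> card S \<le> e}"
    using assms(1) by (intro card_inj_on_le) auto
  then show ?thesis using assms by (simp add: card_subsets_card_le)
qed

section \<open>Distance families, their parity classes and the parity extension\<close>

lemma distance_family_bound:
  assumes "finite L" "\<And>l. l \<in> L \<Longrightarrow> 0 < l" "\<And>l. l \<in> L \<Longrightarrow> 2 * l \<le> n" "1 \<le> n"
    and F: "distance_family L n F"
  shows "card F \<le> (\<Sum>i=0..card L. (n - 1) choose i)"
proof -
  have "card F \<le> card {S. S \<subseteq> {1..n} \<and> card S \<le> card L \<and> even (card L + card S)}"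
    using assms by (intro distance_code_inertia_bound) (auto simp: distance_family_def)
  also have "\<dots> \<le> (\<Sum>i=0..card L. (n - 1) choose i)"
    using card_subsets_card_le_parity[of "{1..n}" 1] assms(4) by simp
  finally show ?thesis .
qed

lemma even_card_sym_diff_iff:
  assumes "finite A" "finite B"
  shows "even (card (sym_diff A B)) \<longleftrightarrow> (even (card A) \<longleftrightarrow> even (card B))"
proof -
  have "card (sym_diff A B) = card (A - B) + card (B - A)"
    using assms by (intro card_Un_disjoint) auto
  moreover have "card A = card (A - B) + card (A \<inter> B)" "card B = card (B - A) + card (A \<inter> B)"
    using assms card_Int_Diff[of A B] card_Int_Diff[of B A] by (simp_all add: Int_commute)
  ultimately show ?thesis by auto
qed

text \<open>Splitting \<open>F\<close> by the parity of its members leaves two subfamilies with only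
  even distances, which gives the factor 2 in the general bound.\<close>

lemma distance_family_subset_same_parity:
  assumes F: "distance_family L n F" and G: "G \<subseteq> F"
    and par: "\<And>A B. A \<in> G \<Longrightarrow> B \<in> G \<Longrightarrow> even (card A) \<longleftrightarrow> even (card B)"
  shows "distance_family (even_part L) n G"
  unfolding distance_family_def
proof (intro conjI ballI impI)
  show "G \<subseteq> Pow {1..n}" using F G by (auto simp: distance_family_def)
  fix A B assume AB: "A \<in> G" "B \<in> G" "A \<noteq> B"
  then have d: "card (sym_diff A B) \<in> L" and "A \<subseteq> {1..n}" "B \<subseteq> {1..n}"
    using F G unfolding distance_family_def by blast+
  then have "finite A" "finite B" by (simp_all add: finite_subset)
  from even_card_sym_diff_iff[OF this] show "card (sym_diff A B) \<in> even_part L"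
    using d par[OF AB(1,2)] unfolding even_part_def by blast
qed

text \<open>For \<open>A \<subseteq> {1..n}\<close> the element \<open>Suc n\<close> is a fresh
  coordinate serving as a parity bit: the extended set always has even size.\<close>

definition parity_extension :: "nat \<Rightarrow> nat set \<Rightarrow> nat set" where
  "parity_extension n A = (if even (card A) then A else insert (Suc n) A)"

text \<open>The parity bits differ exactly when the distance is odd, so odd distances are raised to
  the next even number.\<close>

lemma card_sym_diff_parity_extension:
  assumes "A \<subseteq> {1..n}" "B \<subseteq> {1..n}"
  shows "card (sym_diff (parity_extension n A) (parity_extension n B)) =
    (if even (card (sym_diff A B)) then card (sym_diff A B) else Suc (card (sym_diff A B)))"
proof -
  have fin: "finite A" "finite B" and notin: "Suc n \<notin> A" "Suc n \<notin> B"
    using assms by (auto intro: finite_subset)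
  have "sym_diff (parity_extension n A) (parity_extension n B) =
    (if even (card A) \<longleftrightarrow> even (card B) then sym_diff A B else insert (Suc n) (sym_diff A B))"
    using notin by (auto simp: parity_extension_def)
  then show ?thesis using fin notin by (simp add: even_card_sym_diff_iff)
qed

lemma inj_on_parity_extension: "inj_on (parity_extension n) (Pow {1..n})"
proof (rule inj_onI)
  fix A B assume AB: "A \<in> Pow {1..n}" "B \<in> Pow {1..n}"
    and eq: "parity_extension n A = parity_extension n B"
  have "parity_extension n C \<inter> {1..n} = C" if "C \<in> Pow {1..n}" for C
    using that by (auto simp: parity_extension_def)
  then show "A = B" using AB eq by metis
qed

lemma distance_family_parity_extension:
  assumes F: "distance_family L n F" and odd: "(\<lambda>l. l + 1) ` odd_part L \<subseteq> even_part L"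
  shows "distance_family (even_part L) (Suc n) (parity_extension n ` F)"
  unfolding distance_family_def
proof (intro conjI ballI impI)
  show "parity_extension n ` F \<subseteq> Pow {1..Suc n}"
  proof (rule image_subsetI)
    fix A assume "A \<in> F"
    then have "A \<subseteq> {1..n}" using F unfolding distance_family_def by blast
    then show "parity_extension n A \<in> Pow {1..Suc n}" by (auto simp: parity_extension_def)
  qed
  fix A' B' assume "A' \<in> parity_extension n ` F" "B' \<in> parity_extension n ` F" "A' \<noteq> B'"
  then obtain A B where AB: "A \<in> F" "B \<in> F" "A \<noteq> B"
    and eq: "A' = parity_extension n A" "B' = parity_extension n B" by auto
  have d: "card (sym_diff A B) \<in> L" using F AB by (auto simp: distance_family_def)
  have sub: "A \<subseteq> {1..n}" "B \<subseteq> {1..n}" using F AB by (auto simp: distance_family_def)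
  show "card (sym_diff A' B') \<in> even_part L"
  proof (cases "even (card (sym_diff A B))")
    case True
    then show ?thesis
      unfolding eq card_sym_diff_parity_extension[OF sub] using d by (simp add: even_part_def)
  next
    case False
    then have "card (sym_diff A B) \<in> odd_part L" using d by (simp add: odd_part_def even_part_def)
    then have "Suc (card (sym_diff A B)) \<in> even_part L" using odd by auto
    then show ?thesis
      unfolding eq card_sym_diff_parity_extension[OF sub] using False by simp
  qed
qed

theorem corollary4p3:
  fixes L :: "nat set"
  assumes "finite L" and "\<forall>l\<in>L. 0 < l"
  shows "\<exists>n0. \<forall>n\<ge>n0. \<forall>F. distance_family L n F \<longrightarrow>
    card F \<le> (if L \<subseteq> {l. even l}
               then (\<Sum>i=0..card (even_part L). (n - 1) choose i)
               else 2 * (\<Sum>i=0..card (even_part L). (n - 1) choose i)) \<and>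
    (\<not> L \<subseteq> {l. even l} \<and> (\<lambda>l. l + 1) ` odd_part L \<subseteq> even_part L \<longrightarrow>
       card F \<le> (\<Sum>i=0..card (even_part L). n choose i))"
\<comment> \<open>Each \<open>l \<in> L\<close> is at most \<open>\<Sum>L\<close>, so
  \<open>2 * l \<le> n\<close>; the summand 1 keeps \<open>n\<close> positive even when
  \<open>L\<close> is empty.\<close>
proof (intro exI[of _ "2 * \<Sum>L + 1"] allI impI)
  fix n F assume n: "2 * \<Sum>L + 1 \<le> n" and F: "distance_family L n F"
  let ?e = "card (even_part L)"
  have sub: "even_part L \<subseteq> L" by (auto simp: even_part_def)
  have large: "2 * l \<le> n" if "l \<in> L" for l
    using member_le_sum[OF that, of "\<lambda>l. l"] assms(1) n by simp
  \<comment> \<open>Stated for every \<open>m \<ge> n\<close> because the parity extension lives in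
    dimension \<open>Suc n\<close>.\<close>
  have bound: "card G \<le> (\<Sum>i=0..?e. (m - 1) choose i)"
    if "distance_family (even_part L) m G" "n \<le> m" for G m
  proof (rule distance_family_bound[OF _ _ _ _ that(1)])
    show "finite (even_part L)" using assms(1) sub by (rule rev_finite_subset)
    show "0 < l" if "l \<in> even_part L" for l using that sub assms(2) by auto
    show "2 * l \<le> m" if "l \<in> even_part L" for l using that sub large[of l] \<open>n \<le> m\<close> by auto
    show "1 \<le> m" using n \<open>n \<le> m\<close> by simp
  qed
  have "card F \<le> (\<Sum>i=0..?e. (n - 1) choose i)" if "L \<subseteq> {l. even l}"
  proof -
    have "even_part L = L" using that by (auto simp: even_part_def)
    then show ?thesis using bound[of n F] F by simp
  qed
  moreover have "card F \<le> 2 * (\<Sum>i=0..?e. (n - 1) choose i)"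
  proof -
    have "F = {A \<in> F. even (card A)} \<union> {A \<in> F. odd (card A)}" by auto
    then have "card F \<le> card {A \<in> F. even (card A)} + card {A \<in> F. odd (card A)}"
      by (metis card_Un_le)
    moreover have "card {A \<in> F. even (card A)} \<le> (\<Sum>i=0..?e. (n - 1) choose i)"
      by (intro bound distance_family_subset_same_parity[OF F]) auto
    moreover have "card {A \<in> F. odd (card A)} \<le> (\<Sum>i=0..?e. (n - 1) choose i)"
      by (intro bound distance_family_subset_same_parity[OF F]) auto
    ultimately show ?thesis by simp
  qed
  moreover have "card F \<le> (\<Sum>i=0..?e. n choose i)" if "(\<lambda>l. l + 1) ` odd_part L \<subseteq> even_part L"
  proof -
    have "card (parity_extension n ` F) = card F"
      using F by (intro card_image inj_on_subset[OF inj_on_parity_extension])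
        (auto simp: distance_family_def)
    \<comment> \<open>Here \<open>m = Suc n\<close>, so \<open>m - 1 = n\<close> yields the
      binomials \<open>n choose i\<close>.\<close>
    then show ?thesis
      using bound[OF distance_family_parity_extension[OF F that]] by simp
  qed
  ultimately show "card F \<le> (if L \<subseteq> {l. even l}
               then (\<Sum>i=0..card (even_part L). (n - 1) choose i)
               else 2 * (\<Sum>i=0..card (even_part L). (n - 1) choose i)) \<and>
    (\<not> L \<subseteq> {l. even l} \<and> (\<lambda>l. l + 1) ` odd_part L \<subseteq> even_part L \<longrightarrow>
       card F \<le> (\<Sum>i=0..card (even_part L). n choose i))"
    by simp
qed

end
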